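(* Let $n$ be even and let $$H_n=\frac12\sum_{p\in\mathbb{Z}_n}(I-Z_pZ_{p+1})$$ be the ring of disagrees Hamiltonian on $n$ qubits. Let $U$ be a $\mathbb{Z}_2$-symmetric unitary on $n$ qubits with range $R<n/4$. Then $$\frac1n\langle+^n|U^\dagger H_nU|+^n\rangle\le\frac{2R+1/2}{2R+1}.$$ This bound is tight whenever $n$ is a multiple of $2R+1$, i.e., in that case there exists a $\mathbb{Z}_2$-symmetric unitary $U$ with range $R$ for which equality holds.
   Context: Qubits are located at the vertices of the cycle graph $\mathbb{Z}_n$ (vertices $\mathbb{Z}_n$, edges $\{j,j+1\}$, arithmetic modulo $n$). $Z_j$ is the Pauli-$Z$ operator on qubit $j$, $X$ is Pauli-$X$, and $|+^n\rangle=|+\rangle^{\otimes n}$ with $|+\rangle=(|0\rangle+|1\rangle)/\sqrt2$. A unitary $U$ on $n$ qubits is $\mathbb{Z}_2$-symmetric if $UX^{\otimes n}=X^{\otimes n}U$. For an integer $R\ge0$, a unitary $U$ has range $R$ if for every qubit $j$ the operator $U^\dagger Z_jU$ has support on the interval $[j-R,j+R]$ of the cycle, i.e., it acts as the identity on all qubits outside $\{j-R,\dots,j+R\}$ (modulo $n$). *)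

theory Defs
  imports Complex_Main "Jordan_Normal_Form.Schur_Decomposition"
begin

text \<open>
  Operators and states on \<open>n\<close> qubits are complex matrices and vectors of dimension \<open>2 ^ n\<close>,
  written in the computational basis. The basis index \<open>x < 2 ^ n\<close> stands for the product state
  in which qubit \<open>j < n\<close> is in the state given by the binary digit \<open>bit x j\<close>. The vertices of the
  cycle \<open>\<int>\<^sub>n\<close> are the residues \<open>0, \<dots>, n - 1\<close>.
\<close>

type_synonym cmat = "complex mat"
type_synonym cvec = "complex vec"

definition tensor_op :: "nat \<Rightarrow> (nat \<Rightarrow> cmat) \<Rightarrow> cmat" where
  "tensor_op n A = mat (2 ^ n) (2 ^ n)
     (\<lambda>(x, y). \<Prod>j<n. A j $$ (of_bool (bit x j), of_bool (bit y j)))"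

definition tensor_state :: "nat \<Rightarrow> (nat \<Rightarrow> cvec) \<Rightarrow> cvec" where
  "tensor_state n v = vec (2 ^ n) (\<lambda>x. \<Prod>j<n. v j $ of_bool (bit x j))"

definition pauli_X :: cmat where
  "pauli_X = mat_of_rows_list 2 [[0, 1], [1, 0]]"

definition pauli_Z :: cmat where
  "pauli_Z = mat_of_rows_list 2 [[1, 0], [0, -1]]"

definition ket_plus :: cvec where
  "ket_plus = complex_of_real (1 / sqrt 2) \<cdot>\<^sub>v (unit_vec 2 0 + unit_vec 2 1)"

definition Z_at :: "nat \<Rightarrow> nat \<Rightarrow> cmat" where
  "Z_at n j = tensor_op n (\<lambda>k. if k = j then pauli_Z else 1\<^sub>m 2)"

definition X_all :: "nat \<Rightarrow> cmat" where
  "X_all n = tensor_op n (\<lambda>_. pauli_X)"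

definition plus_state :: "nat \<Rightarrow> cvec" where
  "plus_state n = tensor_state n (\<lambda>_. ket_plus)"

text \<open>The sum runs over \<open>p \<in> \<int>\<^sub>n\<close>, so for \<open>n = 2\<close> the single edge is counted twice.\<close>

definition ring_hamiltonian :: "nat \<Rightarrow> cmat" where
  "ring_hamiltonian n = (1 / 2) \<cdot>\<^sub>m mat (2 ^ n) (2 ^ n)
     (\<lambda>(x, y). \<Sum>p<n. (1\<^sub>m (2 ^ n) - Z_at n p * Z_at n ((p + 1) mod n)) $$ (x, y))"

definition unitary_op :: "nat \<Rightarrow> cmat \<Rightarrow> bool" where
  "unitary_op n U \<longleftrightarrow> U \<in> carrier_mat (2 ^ n) (2 ^ n) \<and>
     mat_adjoint U * U = 1\<^sub>m (2 ^ n) \<and> U * mat_adjoint U = 1\<^sub>m (2 ^ n)"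

definition Z2_symmetric :: "nat \<Rightarrow> cmat \<Rightarrow> bool" where
  "Z2_symmetric n U \<longleftrightarrow> U * X_all n = X_all n * U"

text \<open>
  \<open>A\<close> acts as the identity outside the set \<open>S\<close> of qubits iff \<open>A = B \<otimes> I\<close> for an operator \<open>B\<close> on the
  qubits in \<open>S\<close>. Basis states of the qubits in \<open>S\<close> are represented by the set of those qubits
  that are in state \<open>1\<close>, and \<open>B a b\<close> is the corresponding matrix entry of \<open>B\<close>.
\<close>

definition supported_on :: "nat \<Rightarrow> nat set \<Rightarrow> cmat \<Rightarrow> bool" where
  "supported_on n S A \<longleftrightarrow> A \<in> carrier_mat (2 ^ n) (2 ^ n) \<and>
     (\<exists>B :: nat set \<Rightarrow> nat set \<Rightarrow> complex. \<forall>x < 2 ^ n. \<forall>y < 2 ^ n.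
        A $$ (x, y) =
          (if \<forall>k<n. k \<notin> S \<longrightarrow> bit x k = bit y k
           then B {k \<in> S. bit x k} {k \<in> S. bit y k} else 0))"

definition cyclic_interval :: "nat \<Rightarrow> nat \<Rightarrow> nat \<Rightarrow> nat set" where
  "cyclic_interval n j R = {k. k < n \<and> (\<exists>i::int. \<bar>i\<bar> \<le> int R \<and> int k = (int j + i) mod int n)}"

definition has_range :: "nat \<Rightarrow> nat \<Rightarrow> cmat \<Rightarrow> bool" where
  "has_range n R U \<longleftrightarrow>
     (\<forall>j<n. supported_on n (cyclic_interval n j R) (mat_adjoint U * Z_at n j * U))"

text \<open>
  \<open>expect A \<psi>\<close> is \<open>\<langle>\<psi>| A |\<psi>\<rangle>\<close>; note that \<open>\<bullet>c\<close> conjugates its second argument. It is a complex number: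
  inequalities between such values refer to the order of \<open>Complex_Order\<close>, in which \<open>a \<le> b\<close> means
  \<open>Re a \<le> Re b\<close> and \<open>Im a = Im b\<close>, so a real upper bound also says that the value is real.
\<close>

definition expect :: "cmat \<Rightarrow> cvec \<Rightarrow> complex" where
  "expect A \<psi> = (A *\<^sub>v \<psi>) \<bullet>c \<psi>"

end

theory Submission
  imports Defs
begin

text \<open>
  Let \<open>L = 2R + 1\<close>. The operators \<open>U\<^sup>\<dagger> Z\<^sub>p U\<close> and \<open>U\<^sup>\<dagger> Z\<^sub>q U\<close> with \<open>q = p + L\<close> have disjoint supports
  and are odd under the symmetry, while \<open>|+\<^sup>n\<rangle>\<close> is a symmetric product state; hence \<open>Z\<^sub>p Z\<^sub>q\<close> has
  expectation 0 in the state \<open>U|+\<^sup>n\<rangle>\<close>. Since \<open>L\<close> is odd, a basis string whose qubits \<open>p\<close> and \<open>q\<close> agree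
  cannot alternate along the whole path from \<open>p\<close> to \<open>q\<close>, so each such path contains on average
  at least half an unsatisfied edge. Averaging over \<open>p\<close> gives the bound. It is attained by a
  product of superpositions of the two alternating strings on consecutive blocks of length \<open>L\<close>.
\<close>

section \<open>Bit strings, spins and sums over basis strings\<close>

definition spin :: "nat \<Rightarrow> nat \<Rightarrow> real" where
  "spin x j = (if bit x j then - 1 else 1)"

lemma spin_mult_self [simp]: "spin x j * spin x j = 1"
  by (simp add: spin_def)

lemma bit_ext:
  fixes x y :: nat
  assumes "x < 2 ^ n" "y < 2 ^ n" "\<And>j. j < n \<Longrightarrow> bit x j \<longleftrightarrow> bit y j"
  shows "x = y"
proof -
  have "take_bit n x = take_bit n y"
    using assms(3) by (auto intro!: bit_eqI simp: bit_take_bit_iff)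
  then show ?thesis
    using assms(1,2) by (simp add: take_bit_nat_eq_self)
qed

lemma xor_less_exp:
  fixes x d :: nat
  assumes "x < 2 ^ n" "d < 2 ^ n"
  shows "xor x d < 2 ^ n"
  using assms by (metis take_bit_nat_eq_self take_bit_xor take_bit_nat_less_exp)

lemma xor_xor_cancel [simp]: "xor (xor x d) d = (x :: nat)"
  by (simp add: xor.assoc)

lemma mask_less: "mask n < (2 ^ n :: nat)"
  by (simp add: mask_nat_less_exp)

lemma spin_xor: "spin (xor x d) j = spin x j * spin d j"
  by (simp add: spin_def bit_xor_iff)

lemma sum_xor:
  fixes f :: "nat \<Rightarrow> 'a :: comm_monoid_add"
  assumes "d < 2 ^ n"
  shows "(\<Sum>x<2 ^ n. f (xor x d)) = (\<Sum>x<2 ^ n. f x)"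
  by (rule sum.reindex_bij_witness[where i = "\<lambda>x. xor x d" and j = "\<lambda>x. xor x d"])
     (use assms in \<open>auto simp: xor_less_exp\<close>)

lemma sum_lessThan_double:
  fixes f :: "nat \<Rightarrow> 'a :: comm_monoid_add"
  shows "(\<Sum>x<2 * m. f x) = (\<Sum>y<m. f (2 * y) + f (2 * y + 1))"
  by (induction m) (simp_all add: add_ac)

text \<open>Distributivity: expanding the product on the right picks one bit value per qubit. The
  induction splits off the lowest bit, which shifts the index of \<open>f\<close>, hence
  \<open>f\<close> is arbitrary. This evaluates every sum over a row of the block circuit
  below.\<close>

lemma sum_prod_bits:
  fixes f :: "nat \<Rightarrow> bool \<Rightarrow> 'a :: comm_semiring_1"
  shows "(\<Sum>x<2 ^ n. \<Prod>j<n. f j (bit (x :: nat) j)) = (\<Prod>j<n. f j False + f j True)"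
proof (induction n arbitrary: f)
  case 0
  then show ?case by simp
next
  case (Suc n)
  have "(\<Sum>x<2 ^ Suc n. \<Prod>j<Suc n. f j (bit (x :: nat) j))
      = (\<Sum>y<2 ^ n. (f 0 False + f 0 True) * (\<Prod>j<n. f (Suc j) (bit (y :: nat) j)))"
    by (simp add: sum_lessThan_double prod.lessThan_Suc_shift bit_0 bit_Suc distrib_right
        del: prod.lessThan_Suc)
  also have "\<dots> = (f 0 False + f 0 True) * (\<Prod>j<n. f (Suc j) False + f (Suc j) True)"
    by (simp add: Suc.IH[of "\<lambda>j. f (Suc j)"] flip: sum_distrib_left)
  finally show ?case
    by (simp add: prod.lessThan_Suc_shift del: prod.lessThan_Suc)
qed

section \<open>Entries of adjoints, Pauli operators, symmetric and unitary matrices\<close>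

lemma mult_mat_entry:
  assumes "A \<in> carrier_mat N M" "B \<in> carrier_mat M K" "i < N" "j < K"
  shows "(A * B) $$ (i, j) = (\<Sum>k<M. A $$ (i, k) * B $$ (k, j))"
  using assms by (auto simp: scalar_prod_def lessThan_atLeast0)

lemma mat_adjoint_carrier [simp]:
  assumes "A \<in> carrier_mat N M"
  shows "mat_adjoint A \<in> carrier_mat M N"
  using assms by (auto simp: mat_adjoint_def)

lemma mat_adjoint_entry:
  assumes "(A :: complex mat) \<in> carrier_mat N M" "i < M" "j < N"
  shows "mat_adjoint A $$ (i, j) = cnj (A $$ (j, i))"
  using assms by (auto simp: mat_adjoint_def mat_of_rows_def)

lemma cscalar_prod_mat_adjoint:
  assumes "(A :: complex mat) \<in> carrier_mat N M" "v \<in> carrier_vec M" "w \<in> carrier_vec N"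
  shows "(mat_adjoint A *\<^sub>v w) \<bullet>c v = w \<bullet>c (A *\<^sub>v v)"
proof -
  have "(mat_adjoint A *\<^sub>v w) \<bullet>c v = (\<Sum>i<M. \<Sum>j<N. cnj (A $$ (j, i)) * w $ j * cnj (v $ i))"
    using assms carrier_matD[OF mat_adjoint_carrier[OF assms(1)]]
    by (auto simp: scalar_prod_def mat_adjoint_entry sum_distrib_right simp flip: lessThan_atLeast0
        intro!: sum.cong)
  also have "\<dots> = (\<Sum>j<N. \<Sum>i<M. cnj (A $$ (j, i)) * w $ j * cnj (v $ i))"
    by (rule sum.swap)
  also have "\<dots> = w \<bullet>c (A *\<^sub>v v)"
    using assms
    by (auto simp: scalar_prod_def sum_distrib_left mult_ac simp flip: lessThan_atLeast0
        intro!: sum.cong)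
  finally show ?thesis .
qed

lemma pauli_Z_entry:
  "pauli_Z $$ (of_bool a, of_bool b) = (if a = b then (if a then - 1 else 1) else 0)"
  by (auto simp: pauli_Z_def mat_of_rows_list_def)

lemma pauli_X_entry: "pauli_X $$ (of_bool a, of_bool b) = of_bool (a \<noteq> b)"
  by (auto simp: pauli_X_def mat_of_rows_list_def)

lemma Z_at_carrier [simp]: "Z_at n j \<in> carrier_mat (2 ^ n) (2 ^ n)"
  by (simp add: Z_at_def tensor_op_def)

lemma X_all_carrier [simp]: "X_all n \<in> carrier_mat (2 ^ n) (2 ^ n)"
  by (simp add: X_all_def tensor_op_def)

lemma dim_plus_state [simp]: "dim_vec (plus_state n) = 2 ^ n"
  by (simp add: plus_state_def tensor_state_def)

lemma plus_state_carrier [simp]: "plus_state n \<in> carrier_vec (2 ^ n)"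
  by (simp add: plus_state_def tensor_state_def)

lemma Z_at_entry:
  assumes "x < 2 ^ n" "y < 2 ^ n" "j < n"
  shows "Z_at n j $$ (x, y) = (if x = y then complex_of_real (spin x j) else 0)"
proof (cases "x = y")
  case True
  have "(\<Prod>k<n. (if k = j then pauli_Z else 1\<^sub>m 2) $$ (of_bool (bit x k), of_bool (bit x k)))
      = (\<Prod>k<n. if k = j then complex_of_real (spin x k) else 1)"
    by (intro prod.cong refl) (auto simp: pauli_Z_entry spin_def)
  then show ?thesis
    using assms True by (simp add: Z_at_def tensor_op_def)
next
  case False
  then obtain k where k: "k < n" "bit x k \<noteq> bit y k"
    using assms bit_ext by blast
  then have "(if k = j then pauli_Z else 1\<^sub>m 2) $$ (of_bool (bit x k), of_bool (bit y k)) = 0"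
    by (auto simp: pauli_Z_entry)
  then have "(\<Prod>k<n. (if k = j then pauli_Z else 1\<^sub>m 2)
      $$ (of_bool (bit x k), of_bool (bit y k))) = 0"
    using k(1) by (intro prod_zero[OF finite_lessThan]) blast
  then show ?thesis
    using assms False by (simp add: Z_at_def tensor_op_def)
qed

lemma X_all_entry:
  assumes "x < 2 ^ n" "y < 2 ^ n"
  shows "X_all n $$ (x, y) = of_bool (y = xor x (mask n))"
proof -
  have "X_all n $$ (x, y) = (\<Prod>k<n. of_bool (bit x k \<noteq> bit y k))"
    using assms by (simp add: X_all_def tensor_op_def pauli_X_entry del: of_bool_eq)
  also have "\<dots> = of_bool (\<forall>k<n. bit x k \<noteq> bit y k)"
    by (cases "\<forall>k<n. bit x k \<noteq> bit y k") (auto intro!: prod_zero)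
  also have "(\<forall>k<n. bit x k \<noteq> bit y k) \<longleftrightarrow> y = xor x (mask n)"
    using assms xor_less_exp[OF assms(1) mask_less]
    by (auto simp: bit_xor_iff bit_mask_iff intro!: bit_ext)
  finally show ?thesis .
qed

lemma plus_state_entry:
  assumes "x < 2 ^ n"
  shows "plus_state n $ x = complex_of_real ((1 / sqrt 2) ^ n)"
proof -
  have "ket_plus $ of_bool b = complex_of_real (1 / sqrt 2)" for b
    by (cases b) (simp_all add: ket_plus_def)
  then show ?thesis
    using assms by (simp add: plus_state_def tensor_state_def)
qed

text \<open>\<open>X_all n\<close> is the permutation matrix of the global flip, so commuting with
  it equates the entry of \<open>U\<close> with only the column flipped and the entry with only the
  row flipped. Replacing \<open>y\<close> by its flip gives the form stated here.\<close>

lemma Z2_symmetric_iff: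
  assumes U: "U \<in> carrier_mat (2 ^ n) (2 ^ n)"
  shows "Z2_symmetric n U \<longleftrightarrow>
    (\<forall>x<2 ^ n. \<forall>y<2 ^ n. U $$ (xor x (mask n), xor y (mask n)) = U $$ (x, y))"
proof -
  have l: "(U * X_all n) $$ (x, y) = U $$ (x, xor y (mask n))" if "x < 2 ^ n" "y < 2 ^ n" for x y
  proof -
    have "(U * X_all n) $$ (x, y) = (\<Sum>k<2 ^ n. U $$ (x, k) * of_bool (y = xor k (mask n)))"
      using that by (simp add: mult_mat_entry[OF U X_all_carrier] X_all_entry del: of_bool_eq)
    also have "\<dots> = (\<Sum>k<2 ^ n. if k = xor y (mask n) then U $$ (x, k) else 0)"
      by (intro sum.cong refl) (auto simp: of_bool_def)
    finally show ?thesis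
      using that by (simp add: xor_less_exp mask_less)
  qed
  have r: "(X_all n * U) $$ (x, y) = U $$ (xor x (mask n), y)" if "x < 2 ^ n" "y < 2 ^ n" for x y
  proof -
    have "(X_all n * U) $$ (x, y) = (\<Sum>k<2 ^ n. of_bool (k = xor x (mask n)) * U $$ (k, y))"
      using that by (simp add: mult_mat_entry[OF X_all_carrier U] X_all_entry del: of_bool_eq)
    also have "\<dots> = (\<Sum>k<2 ^ n. if k = xor x (mask n) then U $$ (k, y) else 0)"
      by (intro sum.cong refl) (auto simp: of_bool_def)
    finally show ?thesis
      using that by (simp add: xor_less_exp mask_less)
  qed
  have "Z2_symmetric n U \<longleftrightarrow>
      (\<forall>x<2 ^ n. \<forall>y<2 ^ n. (U * X_all n) $$ (x, y) = (X_all n * U) $$ (x, y))"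
    unfolding Z2_symmetric_def using carrier_matD[OF U] carrier_matD[OF X_all_carrier[of n]]
    by (auto intro!: eq_matI simp del: index_mult_mat(1))
  also have "\<dots> \<longleftrightarrow> (\<forall>x<2 ^ n. \<forall>y<2 ^ n. U $$ (x, xor y (mask n)) = U $$ (xor x (mask n), y))"
    by (simp add: l r)
  also have "\<dots> \<longleftrightarrow> (\<forall>x<2 ^ n. \<forall>y<2 ^ n. U $$ (xor x (mask n), xor y (mask n)) = U $$ (x, y))"
    by (metis xor_less_exp mask_less xor_xor_cancel)
  finally show ?thesis .
qed

lemma unitary_op_rows:
  assumes "unitary_op n U" "x < 2 ^ n" "y < 2 ^ n"
  shows "(\<Sum>z<2 ^ n. U $$ (x, z) * cnj (U $$ (y, z))) = of_bool (x = y)"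
proof -
  have U: "U \<in> carrier_mat (2 ^ n) (2 ^ n)" and "U * mat_adjoint U = 1\<^sub>m (2 ^ n)"
    using assms by (auto simp: unitary_op_def)
  then have "(U * mat_adjoint U) $$ (x, y) = of_bool (x = y)"
    using assms by simp
  then show ?thesis
    using assms by (simp add: mult_mat_entry[OF U mat_adjoint_carrier[OF U]] mat_adjoint_entry[OF U]
        del: of_bool_eq)
qed

lemma unitary_op_columns:
  assumes "unitary_op n U" "x < 2 ^ n" "y < 2 ^ n"
  shows "(\<Sum>z<2 ^ n. cnj (U $$ (z, x)) * U $$ (z, y)) = of_bool (x = y)"
proof -
  have U: "U \<in> carrier_mat (2 ^ n) (2 ^ n)" and "mat_adjoint U * U = 1\<^sub>m (2 ^ n)"
    using assms by (auto simp: unitary_op_def)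
  then have "(mat_adjoint U * U) $$ (x, y) = of_bool (x = y)"
    using assms by simp
  then show ?thesis
    using assms by (simp add: mult_mat_entry[OF mat_adjoint_carrier[OF U] U] mat_adjoint_entry[OF U]
        del: of_bool_eq)
qed

lemma conjugated_Z_entry:
  assumes U: "U \<in> carrier_mat (2 ^ n) (2 ^ n)" and "j < n" "x < 2 ^ n" "y < 2 ^ n"
  shows "(mat_adjoint U * Z_at n j * U) $$ (x, y)
    = (\<Sum>z<2 ^ n. cnj (U $$ (z, x)) * complex_of_real (spin z j) * U $$ (z, y))"
proof -
  have "(mat_adjoint U * Z_at n j) $$ (x, z) = cnj (U $$ (z, x)) * complex_of_real (spin z j)"
    if "z < 2 ^ n" for z
  proof -
    have "(mat_adjoint U * Z_at n j) $$ (x, z)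
        = (\<Sum>k<2 ^ n. if k = z then cnj (U $$ (k, x)) * complex_of_real (spin k j) else 0)"
      unfolding mult_mat_entry[OF mat_adjoint_carrier[OF U] Z_at_carrier \<open>x < 2 ^ n\<close> that]
      by (intro sum.cong refl) (use assms that in \<open>auto simp: mat_adjoint_entry[OF U] Z_at_entry\<close>)
    then show ?thesis
      using that by simp
  qed
  moreover have "mat_adjoint U * Z_at n j \<in> carrier_mat (2 ^ n) (2 ^ n)"
    using U by (intro mult_carrier_mat[OF mat_adjoint_carrier]) auto
  ultimately show ?thesis
    using assms by (simp add: mult_mat_entry[OF _ U])
qed

section \<open>Measurement statistics of the evolved plus state\<close>

definition amplitude :: "nat \<Rightarrow> cmat \<Rightarrow> nat \<Rightarrow> complex" where
  "amplitude n U x = (U *\<^sub>v plus_state n) $ x"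

text \<open>The Born probability of reading \<open>x\<close> from the evolved state in the
  computational basis.\<close>

definition weight :: "nat \<Rightarrow> cmat \<Rightarrow> nat \<Rightarrow> real" where
  "weight n U x = (cmod (amplitude n U x))\<^sup>2"

lemma weight_nonneg: "weight n U x \<ge> 0"
  by (simp add: weight_def)

lemma amplitude_eq:
  assumes "U \<in> carrier_mat (2 ^ n) (2 ^ n)" "x < 2 ^ n"
  shows "amplitude n U x = complex_of_real ((1 / sqrt 2) ^ n) * (\<Sum>y<2 ^ n. U $$ (x, y))"
  using assms carrier_matD[OF assms(1)]
  by (simp add: amplitude_def row_def scalar_prod_def plus_state_entry sum_distrib_left mult.commute
      flip: lessThan_atLeast0)

text \<open>The cut size: the number of cycle edges whose endpoints carry different bits.\<close>

definition energy :: "nat \<Rightarrow> nat \<Rightarrow> real" where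
  "energy n x = (\<Sum>p<n. (1 - spin x p * spin x ((p + 1) mod n)) / 2)"

lemma ring_hamiltonian_entry:
  assumes "x < 2 ^ n" "y < 2 ^ n"
  shows "ring_hamiltonian n $$ (x, y) = (if x = y then complex_of_real (energy n x) else 0)"
proof -
  have zz: "(Z_at n p * Z_at n q) $$ (x, y)
      = (if x = y then complex_of_real (spin x p * spin x q) else 0)" if "p < n" "q < n" for p q
  proof -
    have "(Z_at n p * Z_at n q) $$ (x, y)
        = (\<Sum>k<2 ^ n. if k = x then if x = y then complex_of_real (spin x p * spin x q) else 0 else 0)"
      unfolding mult_mat_entry[OF Z_at_carrier Z_at_carrier assms]
      by (intro sum.cong refl) (use assms that in \<open>auto simp: Z_at_entry\<close>)
    then show ?thesis
      using assms by simp
  qed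
  have carrier: "Z_at n p * Z_at n q \<in> carrier_mat (2 ^ n) (2 ^ n)" for p q
    by (rule mult_carrier_mat[OF Z_at_carrier Z_at_carrier])
  have "(1\<^sub>m (2 ^ n) - Z_at n p * Z_at n ((p + 1) mod n)) $$ (x, y)
      = (if x = y then complex_of_real (1 - spin x p * spin x ((p + 1) mod n)) else 0)"
    if "p < n" for p
    using that assms carrier_matD[OF carrier[of p "(p + 1) mod n"]]
    by (auto simp: zz simp del: index_mult_mat)
  then show ?thesis
    using assms by (simp add: ring_hamiltonian_def energy_def sum_distrib_left sum_divide_distrib
        cong: sum.cong_simp)
qed

lemma ring_hamiltonian_carrier [simp]: "ring_hamiltonian n \<in> carrier_mat (2 ^ n) (2 ^ n)"
  by (simp add: ring_hamiltonian_def)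

text \<open>The Hamiltonian is diagonal with entries \<open>energy n x\<close>. Moving the adjoint
  of \<open>U\<close> to the other side of the inner product leaves the mean energy under the
  outcome probabilities, so both halves of the theorem become statements about a distribution on
  strings.\<close>

lemma expect_conjugated:
  assumes U: "U \<in> carrier_mat (2 ^ n) (2 ^ n)"
  shows "expect (mat_adjoint U * ring_hamiltonian n * U) (plus_state n)
    = complex_of_real (\<Sum>x<2 ^ n. weight n U x * energy n x)"
proof -
  define \<psi> where "\<psi> = U *\<^sub>v plus_state n"
  have \<psi>: "\<psi> \<in> carrier_vec (2 ^ n)"
    using U by (simp add: \<psi>_def)
  have "(mat_adjoint U * ring_hamiltonian n * U) *\<^sub>v plus_state n
      = mat_adjoint U *\<^sub>v (ring_hamiltonian n *\<^sub>v \<psi>)"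
    unfolding \<psi>_def using U mat_adjoint_carrier[OF U]
    by (simp add: assoc_mult_mat_vec[of _ "2 ^ n" "2 ^ n" _ "2 ^ n"]
        mult_carrier_mat[of _ "2 ^ n" "2 ^ n"])
  then have "expect (mat_adjoint U * ring_hamiltonian n * U) (plus_state n)
      = (ring_hamiltonian n *\<^sub>v \<psi>) \<bullet>c \<psi>"
    using U \<psi> by (simp add: expect_def cscalar_prod_mat_adjoint[OF U]
        mult_mat_vec_carrier[OF ring_hamiltonian_carrier] flip: \<psi>_def)
  also have "\<dots> = (\<Sum>x<2 ^ n. (ring_hamiltonian n *\<^sub>v \<psi>) $ x * cnj (\<psi> $ x))"
    using \<psi> by (simp add: scalar_prod_def flip: lessThan_atLeast0)
  also have "\<dots> = (\<Sum>x<2 ^ n. complex_of_real (weight n U x * energy n x))"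
  proof (intro sum.cong refl)
    fix x assume "x \<in> {..<2 ^ n :: nat}"
    then have x: "x < 2 ^ n" by simp
    have "(ring_hamiltonian n *\<^sub>v \<psi>) $ x = (\<Sum>y<2 ^ n. ring_hamiltonian n $$ (x, y) * \<psi> $ y)"
      using x \<psi> carrier_matD[OF ring_hamiltonian_carrier[of n]]
      by (simp add: scalar_prod_def flip: lessThan_atLeast0)
    also have "\<dots> = (\<Sum>y<2 ^ n. if y = x then complex_of_real (energy n x) * \<psi> $ x else 0)"
      by (intro sum.cong refl) (use x in \<open>auto simp: ring_hamiltonian_entry\<close>)
    finally show "(ring_hamiltonian n *\<^sub>v \<psi>) $ x * cnj (\<psi> $ x)
        = complex_of_real (weight n U x * energy n x)"
      using x by (simp add: weight_def amplitude_def complex_norm_square mult.assoc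
          del: of_real_power flip: \<psi>_def)
  qed
  finally show ?thesis by simp
qed

section \<open>Supports, and correlations of disjointly supported observables\<close>

lemma nat_with_bits:
  obtains d :: nat where "d < 2 ^ n" "\<And>k. bit d k \<longleftrightarrow> k < n \<and> k \<in> S"
proof -
  define d :: nat where "d = horner_sum of_bool 2 (map (\<lambda>k. k \<in> S) [0..<n])"
  have bit: "bit d k \<longleftrightarrow> k < n \<and> k \<in> S" for k
    by (auto simp: d_def bit_horner_sum_bit_iff)
  have "take_bit n d = d"
    by (rule bit_eqI) (auto simp: bit_take_bit_iff bit)
  then have "d < 2 ^ n"
    by (metis take_bit_nat_less_exp)
  then show thesis
    using bit that by blast
qed

text \<open>Flipping the same qubits outside \<open>S\<close> in row and column preserves both the
  restrictions to \<open>S\<close> and the agreement outside \<open>S\<close>, and the entry depends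
  on nothing else.\<close>

lemma supported_on_xor:
  assumes "supported_on n S A" "x < 2 ^ n" "y < 2 ^ n" "d < 2 ^ n" "\<And>k. k \<in> S \<Longrightarrow> \<not> bit d k"
  shows "A $$ (xor x d, xor y d) = A $$ (x, y)"
proof -
  obtain B :: "nat set \<Rightarrow> nat set \<Rightarrow> complex" where B: "\<And>x y. x < 2 ^ n \<Longrightarrow> y < 2 ^ n \<Longrightarrow> A $$ (x, y) =
      (if \<forall>k<n. k \<notin> S \<longrightarrow> bit x k = bit y k
       then B {k \<in> S. bit x k} {k \<in> S. bit y k} else 0)"
    using assms(1) unfolding supported_on_def by blast
  have restrict: "{k \<in> S. bit (xor z d) k} = {k \<in> S. bit z k}" for z
    using assms(5) by (auto simp: bit_xor_iff)
  have outside: "(\<forall>k<n. k \<notin> S \<longrightarrow> bit (xor x d) k = bit (xor y d) k)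
      \<longleftrightarrow> (\<forall>k<n. k \<notin> S \<longrightarrow> bit x k = bit y k)"
    by (auto simp: bit_xor_iff)
  have "xor x d < 2 ^ n" "xor y d < 2 ^ n"
    using assms by (simp_all add: xor_less_exp)
  then show ?thesis
    unfolding B[OF assms(2,3)] by (simp only: B outside restrict)
qed

lemma supported_on_mono:
  assumes "supported_on n S A" "S \<subseteq> T"
  shows "supported_on n T A"
proof -
  obtain B :: "nat set \<Rightarrow> nat set \<Rightarrow> complex" where B: "\<And>x y. x < 2 ^ n \<Longrightarrow> y < 2 ^ n \<Longrightarrow> A $$ (x, y) =
      (if \<forall>k<n. k \<notin> S \<longrightarrow> bit x k = bit y k
       then B {k \<in> S. bit x k} {k \<in> S. bit y k} else 0)"
    using assms(1) unfolding supported_on_def by blast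
  \<comment> \<open>Agreement on \<open>T - S\<close> is no longer enforced by the condition outside
    the support, so the new local operator has to test it: it is the old one tensored with the
    identity on \<open>T - S\<close>.\<close>
  let ?B = "\<lambda>a b. if \<forall>k<n. k \<in> T - S \<longrightarrow> (k \<in> a \<longleftrightarrow> k \<in> b) then B (a \<inter> S) (b \<inter> S) else 0"
  have restrict: "{k \<in> T. bit z k} \<inter> S = {k \<in> S. bit z k}" for z :: nat
    using assms(2) by auto
  have "A $$ (x, y) = (if \<forall>k<n. k \<notin> T \<longrightarrow> bit x k = bit y k
      then ?B {k \<in> T. bit x k} {k \<in> T. bit y k} else 0)"
    if "x < 2 ^ n" "y < 2 ^ n" for x y
  proof -
    have inside: "(\<forall>k<n. k \<notin> S \<longrightarrow> bit x k = bit y k) \<longleftrightarrow> (\<forall>k<n. k \<notin> T \<longrightarrow> bit x k = bit y k) \<and>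
        (\<forall>k<n. k \<in> T - S \<longrightarrow> (k \<in> {k \<in> T. bit x k} \<longleftrightarrow> k \<in> {k \<in> T. bit y k}))"
      using assms(2) by blast
    show ?thesis
      unfolding B[OF that] inside restrict by (simp only: if_if_eq_conj)
  qed
  then show ?thesis
    using assms(1) unfolding supported_on_def by (intro conjI exI[of _ ?B]) auto
qed

text \<open>The columns of \<open>U\<close> are orthonormal, so only the diagonal terms of the
  expanded double sum survive: \<open>2 ^ n\<close> of them, each of size
  \<open>1 / 2 ^ n\<close>.\<close>

lemma sum_weight:
  assumes "unitary_op n U"
  shows "(\<Sum>x<2 ^ n. weight n U x) = 1"
proof -
  have U: "U \<in> carrier_mat (2 ^ n) (2 ^ n)"
    using assms by (simp add: unitary_op_def)
  let ?c = "complex_of_real ((1 / sqrt 2) ^ n)"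
  have "complex_of_real (\<Sum>x<2 ^ n. weight n U x)
      = (\<Sum>x<2 ^ n. cnj (amplitude n U x) * amplitude n U x)"
    by (simp add: weight_def complex_norm_square mult.commute del: of_real_power)
  also have "\<dots> = (\<Sum>x<2 ^ n. \<Sum>y<2 ^ n. \<Sum>z<2 ^ n. ?c * ?c * (cnj (U $$ (x, y)) * U $$ (x, z)))"
    by (intro sum.cong refl)
       (simp add: amplitude_eq[OF U] sum_distrib_left sum_distrib_right mult_ac del: of_real_power)
  also have "\<dots> = (\<Sum>y<2 ^ n. \<Sum>z<2 ^ n. \<Sum>x<2 ^ n. ?c * ?c * (cnj (U $$ (x, y)) * U $$ (x, z)))"
    by (subst sum.swap, intro sum.cong refl sum.swap)
  also have "\<dots> = (\<Sum>y<2 ^ n. \<Sum>z<(2 ^ n :: nat). if z = y then ?c * ?c else 0)"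
    by (intro sum.cong refl) (simp add: unitary_op_columns[OF assms] flip: sum_distrib_left)
  also have "\<dots> = (\<Sum>y<(2 ^ n :: nat). ?c * ?c)"
    by simp
  also have "\<dots> = complex_of_real (2 ^ n * ((1 / sqrt 2) ^ n * (1 / sqrt 2) ^ n))"
    by simp
  also have "(2 :: real) ^ n * ((1 / sqrt 2) ^ n * (1 / sqrt 2) ^ n) = 1"
    by (simp flip: power_mult_distrib)
  finally show ?thesis
    by (simp only: of_real_eq_iff)
qed

text \<open>The row sums of \<open>U\<^sup>\<dagger> Z\<^sub>p U\<close> are the entries of \<open>U\<^sup>\<dagger> Z\<^sub>p U |+\<^sup>n\<rangle>\<close> up to a factor. By the symmetry they
  change sign when the qubits of \<open>S\<close> are flipped, whereas those of \<open>U\<^sup>\<dagger> Z\<^sub>q U\<close> are unchanged.\<close>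

lemma correlation_eq_0:
  assumes unitary: "unitary_op n U" and sym: "Z2_symmetric n U" and pq: "p < n" "q < n"
    and S: "supported_on n S (mat_adjoint U * Z_at n p * U)"
    and T: "supported_on n T (mat_adjoint U * Z_at n q * U)"
    and disjoint: "S \<inter> T = {}"
  shows "(\<Sum>x<2 ^ n. weight n U x * (spin x p * spin x q)) = 0"
proof -
  have U: "U \<in> carrier_mat (2 ^ n) (2 ^ n)"
    using unitary by (simp add: unitary_op_def)
  let ?A = "\<lambda>j. mat_adjoint U * Z_at n j * U"
  let ?c = "complex_of_real ((1 / sqrt 2) ^ n)"
  define r where "r j x = (\<Sum>y<2 ^ n. ?A j $$ (x, y))" for j x
  have invariant: "r j (xor x d) = r j x"
    if "supported_on n V (?A j)" "x < 2 ^ n" "d < 2 ^ n" "\<And>k. k \<in> V \<Longrightarrow> \<not> bit d k" for V j x d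
  proof -
    have "r j (xor x d) = (\<Sum>y<2 ^ n. ?A j $$ (xor x d, xor y d))"
      unfolding r_def using that(3) by (rule sum_xor[symmetric])
    also have "\<dots> = r j x"
      unfolding r_def by (intro sum.cong refl supported_on_xor[OF that(1)]) (use that in auto)
    finally show ?thesis .
  qed
  \<comment> \<open>The global flip leaves \<open>U\<close> unchanged and reverses every spin, so
    the conjugated operator changes sign when row and column are both flipped.\<close>
  have odd: "r j (xor x (mask n)) = - r j x" if "j < n" "x < 2 ^ n" for j x
  proof -
    have flip: "?A j $$ (xor x (mask n), xor y (mask n)) = - ?A j $$ (x, y)" if "y < 2 ^ n" for y
    proof -
      let ?x = "xor x (mask n)" and ?y = "xor y (mask n)"
      have "?A j $$ (?x, ?y) = (\<Sum>z<2 ^ n. cnj (U $$ (z, ?x)) * complex_of_real (spin z j) * U $$ (z, ?y))"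
        using \<open>j < n\<close> \<open>x < 2 ^ n\<close> that by (simp add: conjugated_Z_entry[OF U] xor_less_exp mask_less)
      also have "\<dots> = (\<Sum>z<2 ^ n. cnj (U $$ (xor z (mask n), ?x))
          * complex_of_real (spin (xor z (mask n)) j) * U $$ (xor z (mask n), ?y))"
        by (rule sum_xor[OF mask_less, symmetric])
      also have "\<dots> = (\<Sum>z<2 ^ n. - (cnj (U $$ (z, x)) * complex_of_real (spin z j) * U $$ (z, y)))"
        using sym that \<open>x < 2 ^ n\<close> \<open>j < n\<close>
        by (intro sum.cong refl)
           (simp add: Z2_symmetric_iff[OF U] spin_xor spin_def[of "mask n"] bit_mask_iff)
      also have "\<dots> = - ?A j $$ (x, y)"
        using \<open>j < n\<close> \<open>x < 2 ^ n\<close> that by (simp add: conjugated_Z_entry[OF U] sum_negf)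
      finally show ?thesis .
    qed
    have "r j (xor x (mask n)) = (\<Sum>y<2 ^ n. ?A j $$ (xor x (mask n), xor y (mask n)))"
      unfolding r_def by (rule sum_xor[OF mask_less, symmetric])
    then show ?thesis
      by (simp add: flip r_def sum_negf)
  qed
  obtain d :: nat where d: "d < 2 ^ n" "\<And>k. bit d k \<longleftrightarrow> k < n \<and> k \<in> S"
    using nat_with_bits[of n S] by blast
  \<comment> \<open>Flipping \<open>S\<close> amounts to flipping everything, which changes the sign
    of \<open>r p\<close>, and then flipping the complement \<open>e\<close> back, which
    \<open>r p\<close> does not notice.\<close>
  define e where "e = xor d (mask n)"
  have e: "e < 2 ^ n" "\<And>k. bit e k \<longleftrightarrow> k < n \<and> k \<notin> S"
    by (auto simp: e_def d xor_less_exp mask_less bit_xor_iff bit_mask_iff)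
  have rp: "r p (xor x d) = - r p x" if "x < 2 ^ n" for x
  proof -
    have "r p (xor x d) = r p (xor (xor x (mask n)) e)"
      by (simp add: e_def xor.assoc xor.left_commute xor.commute)
    also have "\<dots> = r p (xor x (mask n))"
      by (intro invariant[OF S]) (use that e in \<open>auto simp: xor_less_exp mask_less\<close>)
    finally show ?thesis
      using odd pq that by simp
  qed
  have rq: "r q (xor x d) = r q x" if "x < 2 ^ n" for x
    using disjoint by (intro invariant[OF T]) (use that d in auto)
  \<comment> \<open>Reindexing by the flip of \<open>S\<close> shows that the inner product equals
    its own negative.\<close>
  have "(\<Sum>x<2 ^ n. cnj (r p x) * r q x) = (\<Sum>x<2 ^ n. cnj (r p (xor x d)) * r q (xor x d))"
    by (rule sum_xor[OF d(1), symmetric])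
  also have "\<dots> = - (\<Sum>x<2 ^ n. cnj (r p x) * r q x)"
    by (simp add: rp rq sum_negf)
  finally have zero: "(\<Sum>x<2 ^ n. cnj (r p x) * r q x) = 0"
    by simp
  \<comment> \<open>\<open>g j\<close> is the evolved state after Pauli-Z at \<open>j\<close>, and
    \<open>cr\<close> says that the adjoint of \<open>U\<close> maps it to \<open>?c * r j\<close>.
    The remaining chain is preservation of inner products: the Kronecker delta is inserted and
    expanded by orthonormality of the rows of \<open>U\<close>.\<close>
  define g where "g j x = complex_of_real (spin x j) * amplitude n U x" for j x
  have cr: "?c * r j y = (\<Sum>x<2 ^ n. cnj (U $$ (x, y)) * g j x)" if "j < n" "y < 2 ^ n" for j y
  proof -
    have "r j y = (\<Sum>z<2 ^ n. \<Sum>x<2 ^ n. cnj (U $$ (x, y)) * complex_of_real (spin x j) * U $$ (x, z))"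
      unfolding r_def using that by (simp add: conjugated_Z_entry[OF U])
    also have "\<dots> = (\<Sum>x<2 ^ n. \<Sum>z<2 ^ n. cnj (U $$ (x, y)) * complex_of_real (spin x j) * U $$ (x, z))"
      by (rule sum.swap)
    finally show ?thesis
      by (simp add: g_def amplitude_eq[OF U] sum_distrib_left mult_ac del: of_real_power)
  qed
  have "complex_of_real (\<Sum>x<2 ^ n. weight n U x * (spin x p * spin x q)) = (\<Sum>x<2 ^ n. cnj (g p x) * g q x)"
    by (simp add: g_def weight_def complex_norm_square mult_ac del: of_real_power)
  also have "\<dots> = (\<Sum>x<2 ^ n. \<Sum>z<2 ^ n. of_bool (x = z) * (cnj (g p x) * g q z))"
    by (simp add: of_bool_def if_distrib[of "\<lambda>a. a * _"] cong: if_cong)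
  also have "\<dots> = (\<Sum>x<2 ^ n. \<Sum>z<2 ^ n. \<Sum>y<2 ^ n. U $$ (x, y) * cnj (U $$ (z, y)) * (cnj (g p x) * g q z))"
    by (intro sum.cong refl) (simp add: unitary_op_rows[OF unitary, symmetric] sum_distrib_right del: of_bool_eq)
  also have "\<dots> = (\<Sum>x<2 ^ n. \<Sum>y<2 ^ n. \<Sum>z<2 ^ n. U $$ (x, y) * cnj (U $$ (z, y)) * (cnj (g p x) * g q z))"
    by (intro sum.cong refl sum.swap)
  also have "\<dots> = (\<Sum>y<2 ^ n. \<Sum>x<2 ^ n. \<Sum>z<2 ^ n. U $$ (x, y) * cnj (U $$ (z, y)) * (cnj (g p x) * g q z))"
    by (rule sum.swap)
  also have "\<dots> = (\<Sum>y<2 ^ n. cnj (?c * r p y) * (?c * r q y))"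
  proof (intro sum.cong refl)
    fix y :: nat assume "y \<in> {..<2 ^ n}"
    then have "cnj (?c * r p y) = (\<Sum>x<2 ^ n. U $$ (x, y) * cnj (g p x))"
      and "?c * r q y = (\<Sum>z<2 ^ n. cnj (U $$ (z, y)) * g q z)"
      by (simp_all only: cr pq lessThan_iff cnj_sum complex_cnj_mult complex_cnj_cnj)
    then show "(\<Sum>x<2 ^ n. \<Sum>z<2 ^ n. U $$ (x, y) * cnj (U $$ (z, y)) * (cnj (g p x) * g q z))
        = cnj (?c * r p y) * (?c * r q y)"
      by (simp only: sum_product) (simp only: mult_ac)
  qed
  also have "\<dots> = ?c * ?c * (\<Sum>y<2 ^ n. cnj (r p y) * r q y)"
    by (simp add: sum_distrib_left mult_ac del: of_real_power)
  finally show ?thesis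
    using zero by (simp del: of_real_sum of_real_mult)
qed

section \<open>The upper bound: counting agreeing edges on paths around the cycle\<close>

lemma sum_shift_mod:
  fixes f :: "nat \<Rightarrow> 'a :: comm_monoid_add"
  assumes "n > 0"
  shows "(\<Sum>p<n. f ((p + i) mod n)) = (\<Sum>p<n. f p)"
proof -
  have "p mod n = q mod n" if "(p + i) mod n = (q + i) mod n" for p q
    using that unfolding nat_mod_eq_iff by simp
  then have "inj_on (\<lambda>p. (p + i) mod n) {..<n}"
    by (intro inj_onI) (metis lessThan_iff mod_less)
  moreover have "(\<lambda>p. (p + i) mod n) ` {..<n} \<subseteq> {..<n}"
    using assms by auto
  ultimately have "bij_betw (\<lambda>p. (p + i) mod n) {..<n} {..<n}"
    by (metis bij_betw_def endo_inj_surj finite_lessThan)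
  then show ?thesis
    by (rule sum.reindex_bij_betw)
qed

text \<open>The right side counts adjacent equal pairs; the left side is 0 if
  \<open>t m = (- 1) ^ m * t 0\<close> and 1 otherwise. A path without equal neighbours alternates,
  and then the left side is 0. For odd \<open>m\<close> the left side indicates
  \<open>t 0 = t m\<close>.\<close>

lemma agreements_on_path:
  fixes t :: "nat \<Rightarrow> real"
  assumes "\<And>i. t i = 1 \<or> t i = - 1"
  shows "(1 - (- 1) ^ m * (t 0 * t m)) / 2 \<le> (\<Sum>i<m. (1 + t i * t (Suc i)) / 2)"
proof (induction m)
  case 0
  then show ?case using assms[of 0] by auto
next
  case (Suc m)
  have "(- 1 :: real) ^ m = 1 \<or> (- 1 :: real) ^ m = - 1"
    by (cases "even m") auto
  \<comment> \<open>One more edge can raise the left side from 0 to 1 only if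
    \<open>t m = t (Suc m)\<close>.\<close>
  then have "(1 - (- 1) ^ Suc m * (t 0 * t (Suc m))) / 2
      \<le> (1 - (- 1) ^ m * (t 0 * t m)) / 2 + (1 + t m * t (Suc m)) / 2"
    using assms[of 0] assms[of m] assms[of "Suc m"] by auto
  then show ?case
    using Suc.IH unfolding sum.lessThan_Suc by linarith
qed

lemma energy_eq:
  "energy n x = real n - (\<Sum>p<n. (1 + spin x p * spin x ((p + 1) mod n)) / 2)"
proof -
  have "energy n x + (\<Sum>p<n. (1 + spin x p * spin x ((p + 1) mod n)) / 2) = (\<Sum>p<n. 1)"
    unfolding energy_def sum.distrib[symmetric] by (intro sum.cong refl) (simp add: field_simps)
  then show ?thesis by simp
qed

text \<open>Double counting: each of the \<open>n\<close> paths of length \<open>2 * R + 1\<close>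
  obeys \<open>agreements_on_path\<close>, and for each offset \<open>i\<close> along the path,
  summing over all starting points runs through every edge once. The total of agreeing edges is
  \<open>real n - energy n x\<close>.\<close>

lemma energy_bound:
  assumes "n > 0"
  shows "(2 * real R + 1) * (real n - energy n x)
    \<ge> (\<Sum>p<n. (1 + spin x p * spin x ((p + (2 * R + 1)) mod n)) / 2)"
proof -
  let ?L = "2 * R + 1"
  let ?e = "\<lambda>p. (1 + spin x p * spin x ((p + 1) mod n)) / 2"
  have "(\<Sum>p<n. (1 + spin x p * spin x ((p + ?L) mod n)) / 2) \<le> (\<Sum>p<n. \<Sum>i<?L. ?e ((p + i) mod n))"
  proof (intro sum_mono)
    fix p assume "p \<in> {..<n}"
    then show "(1 + spin x p * spin x ((p + ?L) mod n)) / 2 \<le> (\<Sum>i<?L. ?e ((p + i) mod n))"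
      using agreements_on_path[of "\<lambda>i. spin x ((p + i) mod n)" ?L]
      by (simp add: spin_def[of _ "_ mod _"] mod_Suc_eq del: sum.lessThan_Suc)
  qed
  also have "\<dots> = (\<Sum>i<?L. \<Sum>p<n. ?e ((p + i) mod n))"
    by (rule sum.swap)
  also have "\<dots> = (\<Sum>i<?L. real n - energy n x)"
    by (intro sum.cong refl) (use sum_shift_mod[OF assms, of ?e] in \<open>simp add: energy_eq\<close>)
  also have "\<dots> = (2 * real R + 1) * (real n - energy n x)"
    by simp
  finally show ?thesis .
qed

text \<open>A common point would make \<open>2 * R + 1 + j - i\<close> a multiple of
  \<open>n\<close> for some offsets \<open>i\<close>, \<open>j\<close> of size at most
  \<open>R\<close>, but this number lies between 1 and \<open>4 * R + 1\<close>.\<close>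

lemma cyclic_interval_disjoint:
  assumes "4 * R + 1 < n" "p < n"
  shows "cyclic_interval n p R \<inter> cyclic_interval n ((p + (2 * R + 1)) mod n) R = {}"
proof -
  have False if i: "\<bar>i\<bar> \<le> int R" "\<bar>j\<bar> \<le> int R"
    and "(int p + i) mod int n = (int ((p + (2 * R + 1)) mod n) + j) mod int n" for i j
  proof -
    have "(int p + i) mod int n = (int p + (2 * int R + 1) + j) mod int n"
      using that(3) by (simp add: zmod_int mod_simps add_ac)
    then have "int n dvd (int p + (2 * int R + 1) + j) - (int p + i)"
      by (metis mod_eq_dvd_iff)
    then have "int n dvd 2 * int R + 1 + j - i"
      by (simp add: algebra_simps)
    moreover have "0 < 2 * int R + 1 + j - i" "2 * int R + 1 + j - i < int n"
      using i assms by auto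
    ultimately show False
      using zdvd_imp_le by fastforce
  qed
  then show ?thesis
    unfolding cyclic_interval_def by fastforce
qed

text \<open>Averaging \<open>energy_bound\<close> over the outcomes gives \<open>real n / 2\<close>
  \<le> \<open>(2 * real R + 1) * (real n - E)\<close>, because qubits at distance
  \<open>2 * R + 1\<close> agree with probability 1/2 (the fact \<open>pair\<close>).\<close>

lemma mean_energy_le:
  assumes U: "unitary_op n U" "Z2_symmetric n U" "has_range n R U" and R: "4 * R + 1 < n"
  shows "1 / real n * (\<Sum>x<2 ^ n. weight n U x * energy n x) \<le> (2 * real R + 1 / 2) / (2 * real R + 1)"
proof -
  define E where "E = (\<Sum>x<2 ^ n. weight n U x * energy n x)"
  have n: "n > 0" using R by simp
  have pair: "(\<Sum>x<2 ^ n. weight n U x * ((1 + spin x p * spin x ((p + (2 * R + 1)) mod n)) / 2)) = 1 / 2"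
    if p: "p < n" for p
  proof -
    let ?q = "(p + (2 * R + 1)) mod n"
    have "(\<Sum>x<2 ^ n. weight n U x * (spin x p * spin x ?q)) = 0"
      using U(3) n p cyclic_interval_disjoint[OF R p]
      by (intro correlation_eq_0[OF U(1,2), where S = "cyclic_interval n p R"
            and T = "cyclic_interval n ?q R"]) (auto simp: has_range_def)
    then have "(\<Sum>x<2 ^ n. weight n U x + weight n U x * (spin x p * spin x ?q)) = 1"
      by (simp add: sum.distrib sum_weight[OF U(1)])
    then show ?thesis
      by (simp add: distrib_left flip: sum_divide_distrib)
  qed
  have "real n / 2 = (\<Sum>p<n. 1 / 2)"
    by simp
  also have "\<dots> = (\<Sum>p<n. \<Sum>x<2 ^ n. weight n U x * ((1 + spin x p * spin x ((p + (2 * R + 1)) mod n)) / 2))"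
    by (intro sum.cong refl) (simp only: pair lessThan_iff)
  also have "\<dots> = (\<Sum>x<2 ^ n. weight n U x * (\<Sum>p<n. (1 + spin x p * spin x ((p + (2 * R + 1)) mod n)) / 2))"
    by (subst sum.swap) (simp only: sum_distrib_left)
  also have "\<dots> \<le> (\<Sum>x<2 ^ n. weight n U x * ((2 * real R + 1) * (real n - energy n x)))"
    by (intro sum_mono mult_left_mono energy_bound n weight_nonneg)
  also have "\<dots> = (\<Sum>x<2 ^ n. ((2 * real R + 1) * real n) * weight n U x
      - (2 * real R + 1) * (weight n U x * energy n x))"
    by (intro sum.cong refl) (simp only: algebra_simps)
  also have "\<dots> = (2 * real R + 1) * ((\<Sum>x<2 ^ n. weight n U x) * real n - E)"
    unfolding sum_subtractf sum_distrib_left[symmetric] E_def by (simp only: algebra_simps)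
  finally have "real n / 2 \<le> (2 * real R + 1) * (real n - E)"
    by (simp add: sum_weight[OF U(1)])
  then have "(2 * real R + 1) * E \<le> (2 * real R + 1 / 2) * real n"
    by (simp add: algebra_simps)
  then show ?thesis
    using n unfolding E_def[symmetric] by (simp add: field_simps)
qed

section \<open>The circuit attaining the bound: blocks of \<open>2 * R + 1\<close> consecutive
  qubits around a centre\<close>

definition centre :: "nat \<Rightarrow> nat \<Rightarrow> nat" where
  "centre R j = (2 * R + 1) * (j div (2 * R + 1)) + R"

lemma centre_div: "centre R j div (2 * R + 1) = j div (2 * R + 1)"
  unfolding centre_def by (subst div_mult_self4) auto

lemma centre_centre [simp]: "centre R (centre R j) = centre R j"
  unfolding centre_def[of R "centre R j"] centre_div by (simp add: centre_def)

lemma centre_near: "\<bar>int (centre R j) - int j\<bar> \<le> int R"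
proof -
  have "j = (2 * R + 1) * (j div (2 * R + 1)) + j mod (2 * R + 1)"
    by (rule mult_div_mod_eq[symmetric])
  moreover have "j mod (2 * R + 1) < 2 * R + 1"
    by simp
  ultimately show ?thesis
    unfolding centre_def by linarith
qed

text \<open>Blocks tile the ring exactly, so the block of \<open>j\<close> is complete and contains
  its centre.\<close>

lemma centre_less:
  assumes "(2 * R + 1) dvd n" "j < n"
  shows "centre R j < n"
proof -
  obtain m where m: "n = (2 * R + 1) * m"
    using assms(1) by blast
  have "centre R j div (2 * R + 1) < m"
    unfolding centre_div using assms(2) m by (simp add: less_mult_imp_div_less mult.commute)
  then show ?thesis
    unfolding m by (simp add: div_less_iff_less_mult mult.commute)
qed

lemma near_in_cyclic_interval:
  assumes "k < n" "\<bar>int k - int j\<bar> \<le> int R"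
  shows "k \<in> cyclic_interval n j R"
  using assms unfolding cyclic_interval_def by (auto intro!: exI[of _ "int k - int j"])

text \<open>Holds when qubit \<open>j\<close> deviates from the alternating pattern through the
  centre of its block; the parity of the sum \<open>j + centre R j\<close> is that of the
  distance.\<close>

definition twisted :: "nat \<Rightarrow> nat \<Rightarrow> nat \<Rightarrow> bool" where
  "twisted R x j \<longleftrightarrow> (bit x j \<noteq> bit x (centre R j)) \<noteq> odd (j + centre R j)"

text \<open>On each block \<open>block_op\<close> is \<open>V\<^sub>1 W V\<^sub>2\<close>, where \<open>V\<^sub>1\<close> and \<open>V\<^sub>2\<close> apply a CNOT from the centre to every
  other qubit and \<open>W\<close> applies a Hadamard gate to every qubit except the centre; \<open>V\<^sub>1\<close> also flips the
  qubits at odd distance from the centre. It maps \<open>|+\<dots>+\<rangle>\<close> to the superposition of the two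
  alternating strings and, for \<open>j\<close> other than the centre \<open>c\<close>, conjugates \<open>Z\<^sub>j\<close> into \<open>\<plusminus> Z\<^sub>c X\<^sub>j\<close>.\<close>

definition gate :: "nat \<Rightarrow> nat \<Rightarrow> nat \<Rightarrow> bool \<Rightarrow> real" where
  "gate R j x b =
     (if centre R j = j then of_bool (bit x j = b)
      else (if b \<noteq> bit x (centre R j) \<and> twisted R x j then - 1 else 1) / sqrt 2)"

text \<open>An entry vanishes unless row and column agree at all centres, so the factors may take
  the centre bit from the row. Each row is then a product vector in the column bits.\<close>

definition block_op :: "nat \<Rightarrow> nat \<Rightarrow> cmat" where
  "block_op n R = mat (2 ^ n) (2 ^ n) (\<lambda>(x, y). complex_of_real (\<Prod>j<n. gate R j x (bit y j)))"

lemma block_op_carrier [simp]: "block_op n R \<in> carrier_mat (2 ^ n) (2 ^ n)"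
  by (simp add: block_op_def)

lemma block_op_entry:
  assumes "x < 2 ^ n" "y < 2 ^ n"
  shows "block_op n R $$ (x, y) = complex_of_real (\<Prod>j<n. gate R j x (bit y j))"
  using assms by (simp add: block_op_def)

lemma gate_norm: "gate R j x False * gate R j x False + gate R j x True * gate R j x True = 1"
  by (auto simp: gate_def)

text \<open>If two rows differ at a centre, the factors there are different basis vectors. Otherwise
  they differ at some other qubit with equal centre bit, so exactly one is twisted there and the
  factors are, up to sign, the two different rows of a Hadamard matrix.\<close>

lemma gate_orthogonal:
  assumes "(2 * R + 1) dvd n" "x < 2 ^ n" "y < 2 ^ n" "x \<noteq> y"
  obtains j where "j < n"
    "gate R j x False * gate R j y False + gate R j x True * gate R j y True = 0"
proof (cases "\<exists>j<n. centre R j = j \<and> bit x j \<noteq> bit y j")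
  case True
  then obtain j where "j < n" "centre R j = j" "bit x j \<noteq> bit y j"
    by blast
  then show thesis
    by (intro that[of j]) (auto simp: gate_def)
next
  case False
  obtain j where j: "j < n" "bit x j \<noteq> bit y j"
    using assms bit_ext by blast
  have c: "bit x (centre R j) = bit y (centre R j)"
    using False centre_less[OF assms(1) j(1)] by auto
  then have "twisted R x j \<noteq> twisted R y j"
    using j by (auto simp: twisted_def)
  moreover have "centre R j \<noteq> j"
    using False j by auto
  ultimately show thesis
    using c j by (intro that[of j]) (auto simp: gate_def)
qed

lemma unitary_block_op:
  assumes "(2 * R + 1) dvd n"
  shows "unitary_op n (block_op n R)"
proof -
  let ?U = "block_op n R"
  have "(\<Sum>z<2 ^ n. ?U $$ (x, z) * cnj (?U $$ (y, z))) = of_bool (x = y)"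
    if xy: "x < 2 ^ n" "y < 2 ^ n" for x y
  proof -
    have "(\<Sum>z<2 ^ n. ?U $$ (x, z) * cnj (?U $$ (y, z)))
        = complex_of_real (\<Sum>z<2 ^ n. \<Prod>j<n. gate R j x (bit (z :: nat) j) * gate R j y (bit z j))"
      by (simp add: block_op_entry xy prod.distrib)
    also have "\<dots> = complex_of_real
        (\<Prod>j<n. gate R j x False * gate R j y False + gate R j x True * gate R j y True)"
      by (subst sum_prod_bits) simp
    also have "(\<Prod>j<n. gate R j x False * gate R j y False + gate R j x True * gate R j y True)
        = of_bool (x = y)"
    proof (cases "x = y")
      case True
      then show ?thesis by (simp add: gate_norm)
    next
      case False
      then obtain j where "j < n"
        "gate R j x False * gate R j y False + gate R j x True * gate R j y True = 0"
        using gate_orthogonal assms xy by blast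
      then have "\<exists>j\<in>{..<n}.
          gate R j x False * gate R j y False + gate R j x True * gate R j y True = 0"
        by blast
      then show ?thesis
        using False by (simp add: prod_zero[OF finite_lessThan])
    qed
    finally show ?thesis by simp
  qed
  \<comment> \<open>Orthonormal rows give a right inverse, which for a square matrix is also a left
    inverse.\<close>
  then have "?U * mat_adjoint ?U = 1\<^sub>m (2 ^ n)"
    using carrier_matD[OF block_op_carrier[of n R]]
      carrier_matD[OF mat_adjoint_carrier[OF block_op_carrier[of n R]]]
    by (intro eq_matI)
       (auto simp: mult_mat_entry[OF block_op_carrier mat_adjoint_carrier[OF block_op_carrier]]
         mat_adjoint_entry[OF block_op_carrier] simp del: index_mult_mat(1))
  then show ?thesis
    unfolding unitary_op_def
    using mat_mult_left_right_inverse[OF block_op_carrier mat_adjoint_carrier[OF block_op_carrier]]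
    by simp
qed

text \<open>The factors depend only on whether pairs of bits differ, which a global flip does not
  change.\<close>

lemma Z2_symmetric_block_op:
  assumes "(2 * R + 1) dvd n"
  shows "Z2_symmetric n (block_op n R)"
proof -
  have "gate R j (xor x (mask n)) (bit (xor y (mask n)) j) = gate R j x (bit y j)"
    if "j < n" for j and x y :: nat
    using that centre_less[OF assms that]
    by (auto simp: gate_def twisted_def bit_xor_iff bit_mask_iff)
  then show ?thesis
    unfolding Z2_symmetric_iff[OF block_op_carrier]
    by (simp add: block_op_entry xor_less_exp mask_less)
qed

text \<open>Entrywise this moves Pauli-Z at \<open>j\<close> from the left of
  \<open>block_op\<close> to its right, where the Hadamard gate turns it into Pauli-X at
  \<open>j\<close> (the flip by \<open>d\<close>) times Pauli-Z at the centre, up to sign. At a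
  centre \<open>d\<close> is 0 and Pauli-Z passes through unchanged.\<close>

lemma spin_block_op:
  assumes dvd: "(2 * R + 1) dvd n" and "j < n" and z: "z < 2 ^ n" and y: "y < 2 ^ n"
    and d: "d < 2 ^ n" "\<And>k. bit d k \<longleftrightarrow> k = j \<and> centre R j \<noteq> j"
  shows "complex_of_real (spin z j) * block_op n R $$ (z, y)
    = complex_of_real ((- 1) ^ (j + centre R j) * spin y (centre R j)) * block_op n R $$ (z, xor y d)"
proof -
  let ?c = "centre R j"
  let ?g = "\<lambda>k. gate R k z (bit y k)" and ?g' = "\<lambda>k. gate R k z (bit (xor y d) k)"
  have c: "?c < n"
    using centre_less dvd \<open>j < n\<close> by blast
  have split: "(\<Prod>k<n. f k) = f j * (\<Prod>k\<in>{..<n} - {j}. f k)" for f :: "nat \<Rightarrow> real"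
    using \<open>j < n\<close> by (simp add: prod.remove)
  have rest: "(\<Prod>k\<in>{..<n} - {j}. ?g k) = (\<Prod>k\<in>{..<n} - {j}. ?g' k)"
    by (intro prod.cong refl) (simp add: bit_xor_iff d)
  have "spin z j * (\<Prod>k<n. ?g k) = (- 1) ^ (j + ?c) * spin y ?c * (\<Prod>k<n. ?g' k)"
  \<comment> \<open>If \<open>z\<close> and \<open>y\<close> disagree at the centre, the centre
    factor makes both sides 0; otherwise only the factor at \<open>j\<close> needs
    comparison.\<close>
  proof (cases "bit z ?c = bit y ?c")
    case True
    have "spin z j * ?g j = (- 1) ^ (j + ?c) * spin y ?c * ?g' j"
    proof (cases "?c = j")
      case centre: True
      then have "?g j = of_bool (bit z j = bit y j)" "?g' j = of_bool (bit z j = bit y j)"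
        "(- 1 :: real) ^ (j + ?c) = 1"
        by (simp_all add: gate_def bit_xor_iff d flip: mult_2)
      then show ?thesis
        by (simp add: centre spin_def)
    next
      case False
      have "(- 1 :: real) ^ (j + ?c) = (if odd (j + ?c) then - 1 else 1)"
        by simp
      moreover have "?g j = (if bit y j \<noteq> bit y ?c \<and> twisted R z j then - 1 else 1) / sqrt 2"
        and "?g' j = (if bit y j = bit y ?c \<and> twisted R z j then - 1 else 1) / sqrt 2"
        using False True by (simp_all add: gate_def bit_xor_iff d)
      moreover have "twisted R z j \<longleftrightarrow> (bit z j \<noteq> bit y ?c) \<noteq> odd (j + ?c)"
        using True by (simp add: twisted_def)
      \<comment> \<open>Flipping \<open>b\<close> toggles the Hadamard sign exactly when qubit
        \<open>j\<close> is twisted, and the twist sign is the product of the signs of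
        \<open>a\<close>, \<open>c\<close> and \<open>odd_dist\<close>.\<close>
      moreover have "(if a then - 1 else 1)
            * ((if b \<noteq> c \<and> (a \<noteq> c) \<noteq> odd_dist then - 1 else 1) / sqrt 2)
          = (if odd_dist then - 1 else 1) * (if c then - 1 else 1)
            * ((if b = c \<and> (a \<noteq> c) \<noteq> odd_dist then - 1 else 1) / sqrt 2)"
        for a b c odd_dist
        by (cases a; cases b; cases c; cases odd_dist) simp_all
      ultimately show ?thesis
        by (simp only: spin_def)
    qed
    then show ?thesis
      unfolding split rest by (simp only: mult.assoc[symmetric])
  next
    case False
    then have "?g ?c = 0" "?g' ?c = 0"
      using d by (auto simp: gate_def bit_xor_iff)
    then have "\<exists>k\<in>{..<n}. ?g k = 0" "\<exists>k\<in>{..<n}. ?g' k = 0"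
      using c by blast+
    then show ?thesis
      by (simp only: prod_zero[OF finite_lessThan] mult_zero_right)
  qed
  then show ?thesis
    by (simp only: block_op_entry z y d xor_less_exp flip: of_real_mult)
qed

lemma supported_on_block_op:
  assumes dvd: "(2 * R + 1) dvd n" and "j < n"
  shows "supported_on n {j, centre R j} (mat_adjoint (block_op n R) * Z_at n j * block_op n R)"
proof -
  let ?U = "block_op n R" and ?c = "centre R j"
  let ?A = "mat_adjoint ?U * Z_at n j * ?U"
  obtain d' :: nat where "d' < 2 ^ n" "\<And>k. bit d' k \<longleftrightarrow> k < n \<and> k \<in> {k. k = j \<and> ?c \<noteq> j}"
    using nat_with_bits[of n "{k. k = j \<and> ?c \<noteq> j}"] by blast
  then obtain d :: nat where d: "d < 2 ^ n" "\<And>k. bit d k \<longleftrightarrow> k = j \<and> ?c \<noteq> j"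
    using \<open>j < n\<close> by auto
  let ?\<kappa> = "\<lambda>s. complex_of_real ((- 1) ^ (j + ?c) * s)"
  have entry: "?A $$ (x, y) = (if x = xor y d then ?\<kappa> (spin y ?c) else 0)"
    if xy: "x < 2 ^ n" "y < 2 ^ n" for x y
  proof -
    have "?A $$ (x, y) = (\<Sum>z<2 ^ n. ?\<kappa> (spin y ?c) * (cnj (?U $$ (z, x)) * ?U $$ (z, xor y d)))"
      unfolding conjugated_Z_entry[OF block_op_carrier \<open>j < n\<close> xy]
      by (intro sum.cong refl)
         (simp only: mult.assoc spin_block_op[OF dvd \<open>j < n\<close> _ xy(2) d] lessThan_iff mult.left_commute)
    also have "\<dots> = ?\<kappa> (spin y ?c) * of_bool (x = xor y d)"
      unfolding sum_distrib_left[symmetric]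
      by (simp only: unitary_op_columns[OF unitary_block_op[OF dvd] xy(1) xor_less_exp[OF xy(2) d(1)]])
    finally show ?thesis
      by simp
  qed
  let ?S = "{j, ?c}"
  \<comment> \<open>The local form of signed Pauli-X at \<open>j\<close> times Pauli-Z at the
    centre: row and column differ at \<open>j\<close> unless \<open>j\<close> is the centre, and the
    column bit at the centre gives the sign.\<close>
  let ?B = "\<lambda>a b. if \<forall>k\<in>?S. (k \<in> a) = ((k \<in> b) \<noteq> (k = j \<and> ?c \<noteq> j))
    then ?\<kappa> (if ?c \<in> b then - 1 else 1) else 0"
  have "?A $$ (x, y) = (if \<forall>k<n. k \<notin> ?S \<longrightarrow> bit x k = bit y k
      then ?B {k \<in> ?S. bit x k} {k \<in> ?S. bit y k} else 0)" if xy: "x < 2 ^ n" "y < 2 ^ n" for x y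
  proof -
    have eq_iff: "x = xor y d \<longleftrightarrow> (\<forall>k<n. k \<notin> ?S \<longrightarrow> bit x k = bit y k) \<and>
        (\<forall>k\<in>?S. (k \<in> {k \<in> ?S. bit x k}) = ((k \<in> {k \<in> ?S. bit y k}) \<noteq> (k = j \<and> ?c \<noteq> j)))"
      (is "_ \<longleftrightarrow> ?rhs")
    proof
      assume "x = xor y d"
      then show ?rhs
        by (auto simp: bit_xor_iff d)
    next
      assume rhs: ?rhs
      show "x = xor y d"
      proof (rule bit_ext[OF xy(1) xor_less_exp[OF xy(2) d(1)]])
        fix k assume "k < n"
        then show "bit x k \<longleftrightarrow> bit (xor y d) k"
          using rhs by (cases "k \<in> ?S") (auto simp: bit_xor_iff d)
      qed
    qed
    have "spin y ?c = (if ?c \<in> {k \<in> ?S. bit y k} then - 1 else 1)"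
      by (simp add: spin_def)
    then show ?thesis
      unfolding entry[OF xy] eq_iff by (simp only: if_if_eq_conj)
  qed
  moreover have "?A \<in> carrier_mat (2 ^ n) (2 ^ n)"
    by (intro mult_carrier_mat[of _ _ "2 ^ n"] mat_adjoint_carrier) auto
  ultimately show ?thesis
    unfolding supported_on_def by (intro conjI exI[of _ ?B]) blast+
qed

lemma has_range_block_op:
  assumes "(2 * R + 1) dvd n"
  shows "has_range n R (block_op n R)"
  unfolding has_range_def
proof (intro allI impI)
  fix j assume j: "j < n"
  have "{j, centre R j} \<subseteq> cyclic_interval n j R"
    using j centre_less[OF assms j] centre_near[of R j] by (auto intro!: near_in_cyclic_interval)
  then show "supported_on n (cyclic_interval n j R)
      (mat_adjoint (block_op n R) * Z_at n j * block_op n R)"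
    by (rule supported_on_mono[OF supported_on_block_op[OF assms j]])
qed

text \<open>The amplitude of \<open>x\<close> is proportional to a product over qubits of row-factor
  sums. At a twisted qubit other than a centre the two terms cancel, so a string of nonzero weight
  has none.\<close>

lemma block_op_alternates:
  assumes "weight n (block_op n R) x \<noteq> 0" "x < 2 ^ n" "j < n"
  shows "spin x j = (- 1) ^ (j + centre R j) * spin x (centre R j)"
proof (cases "centre R j = j")
  case True
  then show ?thesis by simp
next
  case False
  have "amplitude n (block_op n R) x
      = complex_of_real ((1 / sqrt 2) ^ n * (\<Sum>y<2 ^ n. \<Prod>j<n. gate R j x (bit (y :: nat) j)))"
    using assms(2) by (simp add: amplitude_eq[OF block_op_carrier] block_op_entry)
  then have "(\<Sum>y<2 ^ n. \<Prod>j<n. gate R j x (bit (y :: nat) j)) \<noteq> 0"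
    using assms(1) unfolding weight_def by fastforce
  then have "(\<Prod>j<n. gate R j x False + gate R j x True) \<noteq> 0"
    by (simp only: sum_prod_bits[of "\<lambda>j. gate R j x"] not_False_eq_True)
  then have "gate R j x False + gate R j x True \<noteq> 0"
    using assms(3) by (auto simp: prod_zero_iff)
  then have "\<not> twisted R x j"
    using False by (cases "bit x (centre R j)") (auto simp: gate_def)
  then have parity: "odd (j + centre R j) \<longleftrightarrow> bit x j \<noteq> bit x (centre R j)"
    unfolding twisted_def by blast
  have "(- 1 :: real) ^ (j + centre R j) = (if odd (j + centre R j) then - 1 else 1)"
    by simp
  then show ?thesis
    unfolding parity spin_def by simp
qed

lemma sum_block_energies:
  "(\<Sum>p<(2 * R + 1) * m. if (2 * R + 1) dvd Suc p then 1 / 2 else 1)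
    = real m * (2 * real R + 1 / 2)"
proof (induction m)
  case 0
  then show ?case by simp
next
  case (Suc m)
  let ?L = "2 * R + 1"
  let ?f = "\<lambda>p. if ?L dvd Suc p then 1 / 2 else 1 :: real"
  have "(\<Sum>p<?L * Suc m. ?f p) = (\<Sum>p<?L * m + ?L. ?f p)"
    by (simp only: mult_Suc_right add.commute)
  also have "\<dots> = (\<Sum>p<?L * m. ?f p) + (\<Sum>i<?L. ?f (?L * m + i))"
  proof -
    have "sum g {..<a + b} = sum g {..<a} + (\<Sum>i<b. g (a + i))" for g :: "nat \<Rightarrow> real" and a b
      by (induction b) (simp_all add: add.assoc)
    then show ?thesis .
  qed
  also have "(\<Sum>i<?L. ?f (?L * m + i)) = (\<Sum>i<2 * R. 1) + 1 / 2"
  proof -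
    \<comment> \<open>Of the offsets within a block only the last, \<open>2 * R\<close>, marks an
      edge to the next block.\<close>
    have "?f (?L * m + i) = ?f i" for i
      by (simp only: add_Suc_right[symmetric] dvd_add_right_iff[OF dvd_triv_left])
    moreover have "?f i = 1" if "i < 2 * R" for i
      using that by (auto dest: dvd_imp_le)
    moreover have "?f (2 * R) = 1 / 2"
      by simp
    ultimately show ?thesis
      by (simp only: Suc_eq_plus1[symmetric] sum.lessThan_Suc) simp
  qed
  finally show ?case
    using Suc.IH by (simp add: algebra_simps)
qed

lemma mean_energy_block_op:
  assumes "n > 0" "even n" and dvd: "(2 * R + 1) dvd n"
  shows "1 / real n * (\<Sum>x<2 ^ n. weight n (block_op n R) x * energy n x)
    = (2 * real R + 1 / 2) / (2 * real R + 1)"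
proof -
  let ?U = "block_op n R" and ?L = "2 * R + 1"
  obtain m where m: "n = ?L * m"
    using dvd by blast
  \<comment> \<open>One block would make \<open>n\<close> odd. With two or more, every boundary
    edge, including the one that closes the ring, joins different blocks.\<close>
  have "m \<ge> 2"
    using assms(1,2) m by (cases "m = 1") auto
  have edge: "(\<Sum>x<2 ^ n. weight n ?U x * ((1 - spin x p * spin x ((p + 1) mod n)) / 2))
      = (if ?L dvd Suc p then 1 / 2 else 1)" if p: "p < n" for p
  proof (cases "?L dvd Suc p")
    case True
    let ?q = "(p + 1) mod n"
    have "Suc p div ?L = Suc (p div ?L)"
      using True by (simp add: div_Suc dvd_eq_mod_eq_0)
    moreover have "p div ?L > 0" if "Suc p = n"
    proof -
      have "?L * 2 \<le> Suc p"
        unfolding that m using \<open>m \<ge> 2\<close> by (rule mult_le_mono2)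
      then have "?L \<le> p"
        by presburger
      then show ?thesis
        by (simp add: div_greater_zero_iff)
    qed
    ultimately have neq: "?q div ?L \<noteq> p div ?L"
      using p by (cases "Suc p = n") auto
    \<comment> \<open>The two-point supports are essential: the cyclic intervals of neighbouring
      qubits overlap once \<open>R\<close> is positive. Disjointness makes the ends of a boundary
      edge uncorrelated, so it is cut with probability 1/2.\<close>
    have "{p, centre R p} \<inter> {?q, centre R ?q} = {}"
      using neq centre_div[of R p] centre_div[of R ?q] by fastforce
    then have "(\<Sum>x<2 ^ n. weight n ?U x * (spin x p * spin x ?q)) = 0"
      using p assms(1)
      by (intro correlation_eq_0[OF unitary_block_op[OF dvd] Z2_symmetric_block_op[OF dvd]
            _ _ supported_on_block_op[OF dvd] supported_on_block_op[OF dvd]]) auto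
    then have "(\<Sum>x<2 ^ n. weight n ?U x - weight n ?U x * (spin x p * spin x ?q)) = 1"
      by (simp add: sum_subtractf sum_weight[OF unitary_block_op[OF dvd]])
    then show ?thesis
      using True by (simp add: right_diff_distrib flip: sum_divide_distrib)
  next
    case False
    then have "Suc p \<noteq> n"
      using dvd by auto
    then have q: "(p + 1) mod n = Suc p" "Suc p < n"
      using p by auto
    have c: "centre R (Suc p) = centre R p"
      using False by (simp add: centre_def div_Suc dvd_eq_mod_eq_0)
    \<comment> \<open>Inside a block both spins follow the same alternating pattern, so the edge is
      cut in every string of nonzero weight.\<close>
    have "weight n ?U x * ((1 - spin x p * spin x (Suc p)) / 2) = weight n ?U x"
      if "x < 2 ^ n" for x
    proof (cases "weight n ?U x = 0")
      case True
      then show ?thesis by simp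
    next
      case False
      define e s where "e = (- 1 :: real) ^ (p + centre R p)" and "s = spin x (centre R p)"
      have "spin x p = e * s" "spin x (Suc p) = - (e * s)"
        using block_op_alternates[OF False that p] block_op_alternates[OF False that q(2)]
        by (simp_all add: c e_def s_def)
      then have "spin x p * spin x (Suc p) = - ((e * e) * (s * s))"
        by simp
      also have "\<dots> = - 1"
        by (simp add: e_def s_def flip: power_mult_distrib)
      finally show ?thesis by simp
    qed
    then have "(\<Sum>x<2 ^ n. weight n ?U x * ((1 - spin x p * spin x (Suc p)) / 2))
        = (\<Sum>x<2 ^ n. weight n ?U x)"
      by (intro sum.cong refl) (simp only: lessThan_iff)
    then show ?thesis
      unfolding q using False sum_weight[OF unitary_block_op[OF dvd]] by simp
  qed
  have "(\<Sum>x<2 ^ n. weight n ?U x * energy n x)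
      = (\<Sum>p<n. \<Sum>x<2 ^ n. weight n ?U x * ((1 - spin x p * spin x ((p + 1) mod n)) / 2))"
    unfolding energy_def by (simp only: sum_distrib_left) (rule sum.swap)
  also have "\<dots> = (\<Sum>p<n. if ?L dvd Suc p then 1 / 2 else 1)"
    by (intro sum.cong refl edge) simp
  also have "\<dots> = real m * (2 * real R + 1 / 2)"
    unfolding m by (rule sum_block_energies)
  finally have energy: "(\<Sum>x<2 ^ n. weight n ?U x * energy n x) = real m * (2 * real R + 1 / 2)" .
  have n: "real n = (2 * real R + 1) * real m"
    by (simp add: m algebra_simps)
  have cancel: "1 / (a * k) * (k * b) = b / a" if "k \<noteq> 0" for a b k :: real
    using that by simp
  show ?thesis
    unfolding energy n by (rule cancel) (use \<open>m \<ge> 2\<close> in simp)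
qed

theorem theorem2:
  fixes n R :: nat
  assumes "n > 0" and "even n"
  shows "(\<forall>U. unitary_op n U \<and> Z2_symmetric n U \<and> has_range n R U \<and> real R < real n / 4 \<longrightarrow>
            1 / of_nat n * expect (mat_adjoint U * ring_hamiltonian n * U) (plus_state n)
              \<le> complex_of_real ((2 * real R + 1 / 2) / (2 * real R + 1)))
       \<and> ((2 * R + 1) dvd n \<longrightarrow>
            (\<exists>U. unitary_op n U \<and> Z2_symmetric n U \<and> has_range n R U \<and>
              1 / of_nat n * expect (mat_adjoint U * ring_hamiltonian n * U) (plus_state n)
                = complex_of_real ((2 * real R + 1 / 2) / (2 * real R + 1))))"
proof -
  have mean: "1 / of_nat n * expect (mat_adjoint U * ring_hamiltonian n * U) (plus_state n)
      = complex_of_real (1 / real n * (\<Sum>x<2 ^ n. weight n U x * energy n x))"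
    if "U \<in> carrier_mat (2 ^ n) (2 ^ n)" for U
    by (simp add: expect_conjugated[OF that])
  show ?thesis
  proof (intro conjI allI impI)
    fix U assume *: "unitary_op n U \<and> Z2_symmetric n U \<and> has_range n R U \<and> real R < real n / 4"
    then have "real (4 * R) < real n"
      by simp
    then have "4 * R < n"
      by (simp only: of_nat_less_iff)
    \<comment> \<open>Evenness of \<open>n\<close> sharpens \<open>4 * R < n\<close> to
      \<open>4 * R + 1 < n\<close>, which the disjointness of the cyclic intervals requires.\<close>
    moreover have "4 * R + 1 \<noteq> n"
      using \<open>even n\<close> by auto
    ultimately have "4 * R + 1 < n"
      by simp
    then have "1 / real n * (\<Sum>x<2 ^ n. weight n U x * energy n x)
        \<le> (2 * real R + 1 / 2) / (2 * real R + 1)"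
      using * by (intro mean_energy_le) auto
    moreover have "U \<in> carrier_mat (2 ^ n) (2 ^ n)"
      using * by (simp add: unitary_op_def)
    ultimately show "1 / of_nat n * expect (mat_adjoint U * ring_hamiltonian n * U) (plus_state n)
        \<le> complex_of_real ((2 * real R + 1 / 2) / (2 * real R + 1))"
      by (simp only: mean less_eq_complex_def Re_complex_of_real Im_complex_of_real)
  next
    assume dvd: "(2 * R + 1) dvd n"
    show "\<exists>U. unitary_op n U \<and> Z2_symmetric n U \<and> has_range n R U \<and>
        1 / of_nat n * expect (mat_adjoint U * ring_hamiltonian n * U) (plus_state n)
          = complex_of_real ((2 * real R + 1 / 2) / (2 * real R + 1))"
      using unitary_block_op[OF dvd] Z2_symmetric_block_op[OF dvd] has_range_block_op[OF dvd]
        mean[OF block_op_carrier] mean_energy_block_op[OF assms dvd]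
      by (intro exI[of _ "block_op n R"]) (simp only:)
  qed
qed

end
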